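(* Let $d,n$ be fixed integers such that $1<d\le n-1$. (a) Let $\lambda\in\mathbb{R}$ with $\lambda>0$. Among all trees with order $n$ and diameter $d$, the tree $\mathbf{T}_{d,n}$ is the unique tree (up to isomorphism) that minimises the generalised Wiener index $W^{\lambda}(T)$. (b) Let $\lambda\in\mathbb{R}$ with $\lambda<0$. Among all trees with order $n$ and diameter $d$, the tree $\mathbf{T}_{d,n}$ is the unique tree (up to isomorphism) that maximises the generalised Wiener index $W^{\lambda}(T)$.
   Context: For a connected graph $G$, $W^{\lambda}(G)=\sum d(u,v)^{\lambda}$, the sum over all unordered pairs $\{u,v\}$ of distinct vertices of $G$, where $d(u,v)$ is the usual distance. For integers $2\le d\le n-1$, $\mathbf{T}_{d,n}$ is the tree obtained by attaching $n-d-1$ pendent edges to a centre vertex of the path of order $d+1$. *)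

theory Defs
  imports Complex_Main "Graph_Theory.Graph_Theory"
begin

text \<open>
  A finite simple graph is a \<^locale>\<open>pair_graph\<close>: every undirected edge is
  represented by its two opposite arcs.  Traversing an edge back and forth is then
  a \<^const>\<open>pre_digraph.cycle\<close> of length two (so that the library's
  \<^const>\<open>tree\<close> is not the right notion here), and the cycles of the
  undirected graph are those of length at least three.
\<close>

definition undirected_tree :: "'a pair_pre_digraph \<Rightarrow> bool" where
  "undirected_tree G \<longleftrightarrow>
     pair_graph G \<and> Digraph_Component.connected (with_proj G) \<and>
     \<not> (\<exists>p. pre_digraph.cycle (with_proj G) p \<and> length p \<ge> 3)"

definition gdist :: "'a pair_pre_digraph \<Rightarrow> 'a \<Rightarrow> 'a \<Rightarrow> real" where
  "gdist G u v = real_of_ereal (wf_digraph.\<mu> (with_proj G) (\<lambda>_. 1) u v)"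

definition gdiameter :: "'a pair_pre_digraph \<Rightarrow> real" where
  "gdiameter G = Max {gdist G u v |u v. u \<in> pverts G \<and> v \<in> pverts G}"

text \<open>
  The sum ranges over two-element vertex sets; the description is well-defined because
  distance is symmetric, see \<open>wiener_summand\<close> below.
\<close>

definition wiener :: "real \<Rightarrow> 'a pair_pre_digraph \<Rightarrow> real" where
  "wiener \<alpha> G =
     (\<Sum>P | P \<subseteq> pverts G \<and> card P = 2.
        (THE x. \<exists>u v. P = {u, v} \<and> x = gdist G u v powr \<alpha>))"

lemma gdist_commute:
  assumes "pair_graph G"
  shows "gdist G u v = gdist G v u"
proof -
  interpret pair_graph G by fact
  have len: "awalk_cost (\<lambda>_. 1) p = real (length p)" for p :: "('a \<times> 'a) list"
    by (induction p) simp_all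
  have len_rev: "length (rev_path p) = length p" for p :: "('a \<times> 'a) list"
    by (induction p) auto
  have le: "\<mu> (\<lambda>_. 1) x y \<le> \<mu> (\<lambda>_. 1) y x" for x y
    unfolding \<mu>_def
  proof (rule INF_mono)
    fix p assume "p \<in> {p. awalk y p x}"
    then have "rev_path p \<in> {p. awalk x p y}"
      by simp
    then show "\<exists>q\<in>{p. awalk x p y}. ereal (awalk_cost (\<lambda>_. 1) q) \<le> ereal (awalk_cost (\<lambda>_. 1) p)"
      by (intro bexI[of _ "rev_path p"]) (simp_all add: len len_rev)
  qed
  show ?thesis
    unfolding gdist_def using le[of u v] le[of v u] by simp
qed

lemma wiener_summand:
  assumes "pair_graph G"
  shows "(THE x. \<exists>a b. {u, v} = {a, b} \<and> x = gdist G a b powr \<alpha>) = gdist G u v powr \<alpha>"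
  using gdist_commute[OF assms, of u v] by (intro the_equality) (auto simp: doubleton_eq_iff)

text \<open>
  The path is \<open>0, 1, \<dots>, d\<close>, with centre vertex \<open>d div 2\<close>.  For odd \<open>d\<close>
  the other centre vertex \<open>Suc (d div 2)\<close> would give an isomorphic tree, by reversing the path.
\<close>

definition centre_tree :: "nat \<Rightarrow> nat \<Rightarrow> nat pair_pre_digraph" where
  "centre_tree d n =
     (let E = {(i, Suc i) |i. i < d} \<union> {(d div 2, j) |j. d < j \<and> j < n}
      in \<lparr> pverts = {..<n}, parcs = E \<union> E\<inverse> \<rparr>)"

definition trees_order_diameter :: "nat \<Rightarrow> nat \<Rightarrow> 'a pair_pre_digraph set" where
  "trees_order_diameter n d =
     {T. undirected_tree T \<and> card (pverts T) = n \<and> gdiameter T = real d}"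

end

theory Submission
  imports Defs
begin

text \<open>
  Fix a tree of order \<open>n\<close> and a path \<open>v 0, \<dots>, v d\<close> in it realising the diameter.  For an increasing
  weight \<open>f\<close> of distances, the sum of all \<open>f (D x y)\<close> splits into pairs on the path, mixed pairs, and
  pairs off the path.  Pairs on the path contribute the same in every tree.

  A vertex \<open>x\<close> off the path has distances \<open>h + \<bar>i - j\<bar>\<close> to the vertices \<open>v i\<close>, where \<open>v j\<close> is the
  vertex where it branches off and \<open>h \<ge> 1\<close> (\<open>dist_to_path\<close>).  Their sum is smallest when \<open>h = 1\<close> and
  \<open>j\<close> is a centre (\<open>spread_centre_less\<close>).  Two vertices off the path are at distance at least two unless
  they are adjacent.  Such an edge gains \<open>f 2 - f 1\<close>, but one of its ends is then the parent of the other,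
  and the child has \<open>h \<ge> 2\<close>, which costs at least \<open>f 2 - f 1\<close> in its distances to the path.  Charging
  each edge off the path to its child end (\<open>off_path_sum\<close>, \<open>distance_sum_excess\<close>) gives the lower bound
  in which every vertex off the path is adjacent to a centre and any two of them are at distance two.

  Equality forces exactly these distances.  All vertices off the path then hang on the same centre
  (\<open>attached_of_distance_sum_eq\<close>), which determines the tree up to isomorphism (\<open>attached_isometry\<close>).
  Taking \<open>f k = k powr \<alpha>\<close> for positive \<open>\<alpha>\<close> and \<open>f k = - (k powr \<alpha>)\<close> for negative \<open>\<alpha>\<close> yields
  minimality and maximality, respectively.

  The facts about trees behind this are existence and uniqueness of parents for every choice of root; they
  are collected in the locale \<open>tree_metric\<close> and obtained from connectedness and the absence of cycles
  of length at least three in \<open>undirected_tree_imp_tree_metric\<close>.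
\<close>

section \<open>Trees as distance functions\<close>

text \<open>
  Everything about trees that the extremal argument uses is a statement about distances: adjacency is
  distance one, and for every root \<open>r\<close> a vertex \<open>x\<close> other than \<open>r\<close> has exactly one neighbour that is not
  farther from \<open>r\<close> than \<open>x\<close> is, namely its parent.  The uniqueness is where acyclicity enters: it
  forbids both two parents and an edge between vertices at the same distance from \<open>r\<close>.
\<close>
locale tree_metric =
  fixes V :: "'a set" and D :: "'a \<Rightarrow> 'a \<Rightarrow> nat"
  assumes finite_V: "finite V"
    and dist_eq_0: "u \<in> V \<Longrightarrow> v \<in> V \<Longrightarrow> D u v = 0 \<longleftrightarrow> u = v"
    and dist_commute: "u \<in> V \<Longrightarrow> v \<in> V \<Longrightarrow> D u v = D v u"
    and parent_exists: "r \<in> V \<Longrightarrow> x \<in> V \<Longrightarrow> x \<noteq> r \<Longrightarrow> \<exists>y\<in>V. D x y = 1 \<and> Suc (D r y) = D r x"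
    and parent_unique: "r \<in> V \<Longrightarrow> x \<in> V \<Longrightarrow> y \<in> V \<Longrightarrow> y' \<in> V \<Longrightarrow> D x y = 1 \<Longrightarrow> D x y' = 1 \<Longrightarrow>
      D r y \<le> D r x \<Longrightarrow> D r y' \<le> D r x \<Longrightarrow> y = y'"

text \<open>
  The distance as a natural number.  Rounding loses nothing on a connected graph, see
  \<open>gdist_eq_hop_dist\<close> below.
\<close>
definition hop_dist :: "'a pair_pre_digraph \<Rightarrow> 'a \<Rightarrow> 'a \<Rightarrow> nat" where
  "hop_dist G u v = nat \<lfloor>gdist G u v\<rfloor>"

context pair_graph
begin

lemma awalk_cost_one: "awalk_cost (\<lambda>_. 1) p = real (length p)"
  by (induction p) simp_all

lemma connected_imp_reachable:
  assumes "Digraph_Component.connected (with_proj G)" "u \<in> pverts G" "v \<in> pverts G"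
  shows "u \<rightarrow>\<^sup>*\<^bsub>with_proj G\<^esub> v"
  using symmetric_connected_imp_strongly_connected[OF pair_sym_arcs assms(1)] assms(2,3)
  by (auto simp: strongly_connected_def)

lemma hop_dist_attained:
  assumes "Digraph_Component.connected (with_proj G)" "u \<in> pverts G" "v \<in> pverts G"
  obtains p where "awalk u p v" "length p = hop_dist G u v" "gdist G u v = real (hop_dist G u v)"
proof -
  obtain p where p: "apath u p v" "\<mu> (\<lambda>_. 1) u v = awalk_cost (\<lambda>_. 1) p"
    using min_cost_awalk[OF connected_imp_reachable[OF assms], of "\<lambda>_. 1"] by auto
  then have "gdist G u v = real (length p)"
    by (simp add: gdist_def awalk_cost_one)
  with p show thesis
    by (intro that[of p]) (auto simp: hop_dist_def intro: awalkI_apath)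
qed

lemma hop_dist_le_length:
  assumes "Digraph_Component.connected (with_proj G)" "awalk u p v"
  shows "hop_dist G u v \<le> length p"
proof -
  obtain q where q: "apath u q v" "\<mu> (\<lambda>_. 1) u v = awalk_cost (\<lambda>_. 1) q"
    using min_cost_awalk[of u v "\<lambda>_. 1"] assms(2) by (auto simp: reachable_awalk)
  have "\<mu> (\<lambda>_. 1) u v \<le> awalk_cost (\<lambda>_. 1) p"
    using assms(2) by (rule min_cost_le_walk_cost)
  with q show ?thesis
    by (simp add: gdist_def hop_dist_def awalk_cost_one)
qed

lemma hop_dist_eq_0_iff:
  assumes "Digraph_Component.connected (with_proj G)" "u \<in> pverts G" "v \<in> pverts G"
  shows "hop_dist G u v = 0 \<longleftrightarrow> u = v"
proof
  assume "hop_dist G u v = 0"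
  then show "u = v"
    using hop_dist_attained[OF assms] by (metis awalk_empty_ends length_0_conv)
next
  assume "u = v"
  then show "hop_dist G u v = 0"
    using hop_dist_le_length[OF assms(1), of u "[]" u] assms by (simp add: awalk_Nil_iff)
qed

lemma hop_dist_eq_1_iff:
  assumes "Digraph_Component.connected (with_proj G)" "u \<in> pverts G" "v \<in> pverts G"
  shows "hop_dist G u v = 1 \<longleftrightarrow> (u, v) \<in> parcs G"
proof
  assume *: "hop_dist G u v = 1"
  obtain p where p: "awalk u p v" "length p = hop_dist G u v"
    using hop_dist_attained[OF assms] by metis
  with * obtain e where "p = [e]"
    by (auto simp: length_Suc_conv)
  with p show "(u, v) \<in> parcs G"
    by (cases e) (auto simp: awalk_Cons_iff awalk_Nil_iff)
next
  assume arc: "(u, v) \<in> parcs G"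
  then have "awalk u [(u, v)] v"
    by (auto simp: awalk_Cons_iff awalk_Nil_iff in_arcsD1 in_arcsD2)
  from hop_dist_le_length[OF assms(1) this] have "hop_dist G u v \<le> 1"
    by simp
  moreover have "u \<noteq> v"
    using arc pair_no_loops by fastforce
  ultimately show "hop_dist G u v = 1"
    using hop_dist_eq_0_iff[OF assms] by linarith
qed

lemma hop_dist_parent:
  assumes "Digraph_Component.connected (with_proj G)" "r \<in> pverts G" "x \<in> pverts G" "x \<noteq> r"
  shows "\<exists>y\<in>pverts G. (x, y) \<in> parcs G \<and> Suc (hop_dist G r y) = hop_dist G r x"
proof -
  obtain p where p: "awalk r p x" "length p = hop_dist G r x"
    using hop_dist_attained[OF assms(1-3)] by metis
  with \<open>x \<noteq> r\<close> obtain q e where pe: "p = q @ [e]"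
    by (metis awalk_empty_ends rev_exhaust)
  obtain y where y: "awalk r q y" "e = (y, x)" "(y, x) \<in> parcs G"
    using p pe by (cases e) (auto simp: awalk_Cons_iff awalk_Nil_iff)
  have yV: "y \<in> pverts G" using y by auto
  obtain q' where q': "awalk r q' y" "length q' = hop_dist G r y"
    using hop_dist_attained[OF assms(1,2) yV] by metis
  have "awalk r (q' @ [(y, x)]) x"
    using q' y by (auto simp: awalk_Cons_iff awalk_Nil_iff in_arcsD2)
  from hop_dist_le_length[OF assms(1) this]
  have "hop_dist G r x \<le> Suc (hop_dist G r y)"
    using q' by simp
  moreover have "Suc (hop_dist G r y) \<le> hop_dist G r x"
    using hop_dist_le_length[OF assms(1) y(1)] p pe by simp
  ultimately show ?thesis
    using yV y(3) arcs_symmetric by (intro bexI[of _ y]) auto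
qed

text \<open>
  The vertices of a shortest walk from \<open>r\<close> to \<open>y\<close> other than \<open>y\<close> are strictly closer to
  \<open>r\<close> than \<open>y\<close>, so the walk misses every vertex that is at least as far away as \<open>y\<close>.
\<close>
lemma shortest_walk_avoids:
  assumes "Digraph_Component.connected (with_proj G)" "awalk r p y" "length p = hop_dist G r y"
    and "hop_dist G r y \<le> hop_dist G r x" "x \<noteq> y"
  shows "x \<notin> set (awalk_verts r p)"
proof
  assume "x \<in> set (awalk_verts r p)"
  then obtain q s where qs: "p = q @ s" "awalk r q x" "awalk x s y"
    using awalk_decomp[OF assms(2)] by blast
  then have "length s > 0"
    using assms(5) awalk_empty_ends by blast
  with qs assms(3,4) hop_dist_le_length[OF assms(1) qs(2)] show False
    by simp
qed

text \<open>
  Shorten the walk to a path and close it up through \<open>x\<close>.  As \<open>y\<close> and \<open>y'\<close> differ, the path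
  has an arc, which together with the two arcs at \<open>x\<close> gives length at least three.
\<close>
lemma cycle_through_vertex:
  assumes "(x, y) \<in> parcs G" "(x, y') \<in> parcs G" "y \<noteq> y'"
    and "awalk y p y'" "x \<notin> set (awalk_verts y p)"
  shows "\<exists>c. cycle c \<and> length c \<ge> 3"
proof -
  define q where "q = awalk_to_apath p"
  have q: "apath y q y'" "set q \<subseteq> set p"
    unfolding q_def using assms(4) by (auto intro: apath_awalk_to_apath dest: awalk_to_apath_subset)
  then have qw: "awalk y q y'" by (auto intro: awalkI_apath)
  have x: "x \<notin> set (awalk_verts y q)"
    using assms(5) set_awalk_verts[OF assms(4)] set_awalk_verts[OF qw] q(2) by auto
  have ne: "q \<noteq> []" using qw assms(3) awalk_empty_ends by blast
  let ?c = "(x, y) # q @ [(y', x)]"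
  have "awalk y' [(y', x)] x"
    using arcs_symmetric[OF assms(2)] by (auto simp: awalk_Cons_iff awalk_Nil_iff in_arcsD2)
  with qw have closing: "awalk y (q @ [(y', x)]) x"
    by (rule awalk_appendI)
  then have c: "awalk x ?c x"
    unfolding awalk_Cons_iff using assms(1) by (auto simp del: awalk_append_iff)
  from awalk_verts_append[OF closing]
  have "awalk_verts y (q @ [(y', x)]) = awalk_verts y q @ [x]"
    using qw by simp
  then have "distinct (tl (awalk_verts x ?c))"
    using q(1) x by (simp add: apath_def)
  with c have "cycle ?c" unfolding cycle_def by blast
  moreover have "length ?c \<ge> 3" using ne by (cases q) auto
  ultimately show ?thesis by blast
qed

text \<open>
  Going from \<open>y\<close> to the root along a shortest walk and from there to \<open>y'\<close> never meets \<open>x\<close>;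
  two different such neighbours would therefore lie on a common cycle with \<open>x\<close>.
\<close>
lemma hop_dist_parent_unique:
  assumes con: "Digraph_Component.connected (with_proj G)"
    and acyc: "\<not> (\<exists>p. cycle p \<and> length p \<ge> 3)"
    and r: "r \<in> pverts G"
    and arcs: "(x, y) \<in> parcs G" "(x, y') \<in> parcs G"
    and le: "hop_dist G r y \<le> hop_dist G r x" "hop_dist G r y' \<le> hop_dist G r x"
  shows "y = y'"
proof (rule ccontr)
  assume ne: "y \<noteq> y'"
  have V: "y \<in> pverts G" "y' \<in> pverts G" using arcs by (auto dest: in_arcsD2)
  have xy: "x \<noteq> y" "x \<noteq> y'" using arcs pair_no_loops by fastforce+
  obtain p where p: "awalk r p y" "length p = hop_dist G r y"
    using hop_dist_attained[OF con r V(1)] by metis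
  obtain p' where p': "awalk r p' y'" "length p' = hop_dist G r y'"
    using hop_dist_attained[OF con r V(2)] by metis
  have "x \<notin> set (awalk_verts r p)" "x \<notin> set (awalk_verts r p')"
    using shortest_walk_avoids[OF con p le(1) xy(1)] shortest_walk_avoids[OF con p' le(2) xy(2)] .
  moreover have rp: "awalk y (rev_path p) r" using p by simp
  moreover have w: "awalk y (rev_path p @ p') y'" using rp p'(1) by (rule awalk_appendI)
  ultimately have "x \<notin> set (awalk_verts y (rev_path p @ p'))"
    using set_awalk_verts_append[OF rp p'(1)] awalk_verts_rev_path[OF p(1)] by simp
  from cycle_through_vertex[OF arcs ne w this] acyc show False by blast
qed

text \<open>
  On a cycle of length at least three, a vertex of maximal rank has two different neighbours, and
  neither of them has larger rank.
\<close>
lemma no_cycle_if_ranked: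
  fixes rank :: "'a \<Rightarrow> nat"
  assumes uniq: "\<And>x y y'. (x, y) \<in> parcs G \<Longrightarrow> (x, y') \<in> parcs G \<Longrightarrow>
      rank y \<le> rank x \<Longrightarrow> rank y' \<le> rank x \<Longrightarrow> y = y'"
    and "cycle c"
  shows "length c < 3"
proof (rule ccontr)
  define m where "m = length c"
  \<comment> \<open>The vertices of the cycle, indexed periodically by all natural numbers.\<close>
  define f where "f k = snd (c ! (k mod m))" for k
  assume "\<not> length c < 3"
  then have m: "m \<ge> 3" by (simp add: m_def)
  obtain u where u: "awalk u c u" "distinct (tl (awalk_verts u c))"
    using \<open>cycle c\<close> unfolding cycle_def by auto
  have tl: "tl (pawalk_verts u c) = map snd c" if "pcas u c v" for u v
    using that
  proof (induction c arbitrary: u)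
    case (Cons e c)
    then show ?case by (cases c) auto
  qed simp
  have dist: "distinct (map snd c)" using u tl by (auto simp: awalk_def)
  have succ: "fst (c ! Suc k) = snd (c ! k)" if "pcas u c v" "Suc k < length c" for u v k
    using that
  proof (induction c arbitrary: u k)
    case (Cons e c)
    then show ?case by (cases k; cases c) auto
  qed simp
  have ends: "fst (c ! 0) = snd (c ! (length c - 1))"
  proof -
    have "pcas u c v \<Longrightarrow> c \<noteq> [] \<Longrightarrow> u = fst (c ! 0) \<and> v = snd (c ! (length c - 1))" for v
    proof (induction c arbitrary: u)
      case (Cons e c)
      then show ?case by (cases c) auto
    qed simp
    from this[of u] show ?thesis using u(1) m by (cases "c = []") (auto simp: awalk_def m_def)
  qed
  have arc: "(f k, f (Suc k)) \<in> parcs G" for k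
  proof -
    have km: "k mod m < m" using m by simp
    have "fst (c ! (Suc k mod m)) = f k"
    proof (cases "Suc (k mod m) = m")
      case True
      then have "k mod m = m - 1" by simp
      with True ends show ?thesis by (simp add: f_def mod_Suc m_def)
    next
      case False
      then have "Suc (k mod m) < m" using km by simp
      then show ?thesis
        using succ[of u u "k mod m"] u(1) False by (simp add: f_def mod_Suc m_def awalk_def)
    qed
    then have "(f k, f (Suc k)) = c ! (Suc k mod m)" by (simp add: f_def prod_eq_iff)
    moreover have "Suc k mod m < m" using m by simp
    then have "c ! (Suc k mod m) \<in> set c" by (simp add: m_def)
    ultimately show ?thesis using u(1) by (auto simp: awalk_def)
  qed
  have inj: "i mod m = j mod m" if "f i = f j" for i j
  proof -
    have "i mod m < m" "j mod m < m" using m by simp_all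
    with that nth_eq_iff_index_eq[OF dist, of "i mod m" "j mod m"] show ?thesis
      by (simp add: f_def m_def)
  qed
  define M where "M = Max ((rank \<circ> f) ` {..<m})"
  have "M \<in> (rank \<circ> f) ` {..<m}"
    unfolding M_def using m by (intro Max_in) (auto simp: lessThan_empty_iff)
  then obtain k where k: "k < m" "rank (f k) = M" by auto
  have le: "rank (f i) \<le> M" for i
  proof -
    have "rank (f i) = (rank \<circ> f) (i mod m)" by (simp add: f_def)
    also have "\<dots> \<le> M" unfolding M_def using m by (intro Max_ge) auto
    finally show ?thesis .
  qed
  \<comment> \<open>The predecessor of \<open>f k\<close> is \<open>f (k + (m - 1))\<close>, which avoids a negative index.\<close>
  have "f (Suc k) = f (k + (m - 1))"
  proof (rule uniq)
    show "(f k, f (Suc k)) \<in> parcs G" by (rule arc)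
    have "f (Suc (k + (m - 1))) = f k" using m by (simp add: f_def)
    then show "(f k, f (k + (m - 1))) \<in> parcs G"
      using arc[of "k + (m - 1)"] arcs_symmetric by simp
  qed (auto simp: k le)
  then have "Suc k mod m = (k + (m - 1)) mod m" by (rule inj)
  then have "m dvd (k + (m - 1)) - Suc k"
    using m by (subst mod_eq_dvd_iff_nat[symmetric]) auto
  then have "m dvd m - 2" using m by (simp add: numeral_2_eq_2)
  then show False using m by (auto dest: dvd_imp_le)
qed

end

lemma undirected_tree_imp_tree_metric:
  assumes "undirected_tree G"
  shows "tree_metric (pverts G) (hop_dist G)"
proof -
  interpret pair_graph G using assms by (simp add: undirected_tree_def)
  have con: "Digraph_Component.connected (with_proj G)"
    and acyc: "\<not> (\<exists>p. cycle p \<and> length p \<ge> 3)"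
    using assms by (auto simp: undirected_tree_def)
  show ?thesis
  proof
    show "finite (pverts G)" by (rule pair_finite_verts)
    show "hop_dist G u v = hop_dist G v u" for u v
      using gdist_commute[OF pair_graph] by (simp add: hop_dist_def)
  next
    fix r x y y'
    assume V: "r \<in> pverts G" "x \<in> pverts G" "y \<in> pverts G" "y' \<in> pverts G"
      and 1: "hop_dist G x y = 1" "hop_dist G x y' = 1"
      and le: "hop_dist G r y \<le> hop_dist G r x" "hop_dist G r y' \<le> hop_dist G r x"
    show "y = y'"
      using hop_dist_parent_unique[OF con acyc V(1) _ _ le] 1
        hop_dist_eq_1_iff[OF con V(2,3)] hop_dist_eq_1_iff[OF con V(2,4)] by simp
  qed (use hop_dist_eq_0_iff[OF con] hop_dist_eq_1_iff[OF con] hop_dist_parent[OF con] in \<open>auto\<close>)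
qed

lemma gdist_eq_hop_dist:
  assumes "undirected_tree G" "u \<in> pverts G" "v \<in> pverts G"
  shows "gdist G u v = real (hop_dist G u v)"
proof -
  interpret pair_graph G using assms by (simp add: undirected_tree_def)
  show ?thesis using hop_dist_attained assms by (metis undirected_tree_def)
qed

lemma hop_dist_arc_iff:
  assumes "undirected_tree G" "u \<in> pverts G" "v \<in> pverts G"
  shows "hop_dist G u v = 1 \<longleftrightarrow> (u, v) \<in> parcs G"
proof -
  interpret pair_graph G using assms by (simp add: undirected_tree_def)
  show ?thesis using hop_dist_eq_1_iff assms by (metis undirected_tree_def)
qed

section \<open>Wiener index and isomorphism in terms of distances\<close>

lemma sum_ordered_pairs_eq:
  fixes g :: "'a \<Rightarrow> 'a \<Rightarrow> real" and h :: "'a set \<Rightarrow> real"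
  assumes "finite V" and diag: "\<And>x. x \<in> V \<Longrightarrow> g x x = 0"
    and h: "\<And>x y. x \<in> V \<Longrightarrow> y \<in> V \<Longrightarrow> x \<noteq> y \<Longrightarrow> g x y = h {x, y}"
  shows "(\<Sum>x\<in>V. \<Sum>y\<in>V. g x y) = 2 * (\<Sum>P | P \<subseteq> V \<and> card P = 2. h P)"
proof -
  let ?S = "{(x, y). x \<in> V \<and> y \<in> V \<and> x \<noteq> y}"
  let ?T = "{P. P \<subseteq> V \<and> card P = 2}"
  have finS: "finite ?S"
    by (rule finite_subset[of _ "V \<times> V"]) (use assms(1) in auto)
  have finT: "finite ?T" using assms(1) by simp
  have "(\<Sum>x\<in>V. \<Sum>y\<in>V. g x y) = (\<Sum>(x, y)\<in>V \<times> V. g x y)"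
    by (simp add: sum.cartesian_product)
  also have "\<dots> = (\<Sum>(x, y)\<in>?S. g x y)"
    using assms(1) diag by (intro sum.mono_neutral_right) auto
  also have "\<dots> = (\<Sum>P\<in>?T. \<Sum>e\<in>{e \<in> ?S. {fst e, snd e} = P}. case e of (x, y) \<Rightarrow> g x y)"
    using finS finT by (intro sum.group[symmetric]) auto
  also have "\<dots> = (\<Sum>P\<in>?T. 2 * h P)"
  proof (rule sum.cong[OF refl])
    fix P assume "P \<in> ?T"
    then obtain a b where ab: "P = {a, b}" "a \<noteq> b" "a \<in> V" "b \<in> V"
      by (auto simp: card_2_iff)
    then have "{e \<in> ?S. {fst e, snd e} = P} = {(a, b), (b, a)}"
      by (auto simp: doubleton_eq_iff)
    with ab h[of a b] h[of b a] show "(\<Sum>e\<in>{e \<in> ?S. {fst e, snd e} = P}. case e of (x, y) \<Rightarrow> g x y) = 2 * h P"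
      by (simp add: insert_commute)
  qed
  finally show ?thesis by (simp add: sum_distrib_left)
qed

text \<open>
  The diagonal may be included because \<open>0 powr \<alpha> = 0\<close> for every \<open>\<alpha>\<close>, also for negative ones.
\<close>
lemma twice_wiener_eq:
  assumes "undirected_tree G"
  shows "2 * wiener \<alpha> G = (\<Sum>x\<in>pverts G. \<Sum>y\<in>pverts G. real (hop_dist G x y) powr \<alpha>)"
proof -
  interpret pair_graph G using assms by (simp add: undirected_tree_def)
  interpret tree_metric "pverts G" "hop_dist G" using assms by (rule undirected_tree_imp_tree_metric)
  show ?thesis
    unfolding wiener_def
    by (rule sum_ordered_pairs_eq[symmetric])
      (use dist_eq_0 in \<open>simp_all add: pair_finite_verts wiener_summand[OF pair_graph] gdist_eq_hop_dist[OF assms]\<close>)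
qed

lemma digraph_isoI_arcs:
  assumes "pair_wf_digraph G" "bij_betw \<phi> (pverts G) (pverts H)" "pair_wf_digraph H"
    and "\<And>x y. x \<in> pverts G \<Longrightarrow> y \<in> pverts G \<Longrightarrow> (x, y) \<in> parcs G \<longleftrightarrow> (\<phi> x, \<phi> y) \<in> parcs H"
  shows "digraph_iso (with_proj G) (with_proj H)"
proof -
  interpret G: pair_wf_digraph G by fact
  interpret H: pair_wf_digraph H by fact
  define hom where "hom = \<lparr>iso_verts = \<phi>, iso_arcs = map_prod \<phi> \<phi>, iso_head = snd, iso_tail = fst\<rparr>"
  have inj: "inj_on \<phi> (pverts G)" and im: "\<phi> ` pverts G = pverts H"
    using assms(2) by (auto simp: bij_betw_def)
  have sub: "parcs G \<subseteq> pverts G \<times> pverts G"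
    using G.in_arcsD1 G.in_arcsD2 by auto
  have "inj_on (map_prod \<phi> \<phi>) (parcs G)"
    using map_prod_inj_on[OF inj inj] sub by (rule inj_on_subset)
  then have 1: "G.digraph_isomorphism hom"
    using inj G.wf_digraph by (simp add: G.digraph_isomorphism_def hom_def)
  have "map_prod \<phi> \<phi> ` parcs G = parcs H"
  proof
    show "map_prod \<phi> \<phi> ` parcs G \<subseteq> parcs H"
      using sub assms(4) by auto
    show "parcs H \<subseteq> map_prod \<phi> \<phi> ` parcs G"
    proof (rule subrelI)
      fix a b assume ab: "(a, b) \<in> parcs H"
      then obtain x y where "x \<in> pverts G" "y \<in> pverts G" "a = \<phi> x" "b = \<phi> y"
        using im H.in_arcsD1 H.in_arcsD2 by blast
      with ab assms(4) show "(a, b) \<in> map_prod \<phi> \<phi> ` parcs G"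
        by (intro image_eqI[of _ _ "(x, y)"]) auto
    qed
  qed
  then have "with_proj H = app_iso hom (with_proj G)"
    using im by (simp add: app_iso_def hom_def with_proj_def)
  with 1 show ?thesis unfolding digraph_iso_def by blast
qed

section \<open>Distances to a path in a tree\<close>

context tree_metric
begin

lemma dist_self: "x \<in> V \<Longrightarrow> D x x = 0"
  using dist_eq_0 by simp

text \<open>
  Whichever end of an edge is not farther from \<open>r\<close> is the parent of the other end.
\<close>
lemma dist_adjacent_cases:
  assumes "r \<in> V" "x \<in> V" "y \<in> V" "D x y = 1"
  shows "D r x = Suc (D r y) \<or> D r y = Suc (D r x)"
proof -
  have step: "Suc (D r b) = D r a" if "a \<in> V" "b \<in> V" "D a b = 1" "D r b \<le> D r a" for a b
  proof -
    have "a \<noteq> r"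
      using that assms(1) dist_eq_0 by fastforce
    with assms(1) \<open>a \<in> V\<close> obtain c where "c \<in> V" "D a c = 1" "Suc (D r c) = D r a"
      using parent_exists by blast
    with parent_unique[OF assms(1) that(1,2), of c] that show ?thesis
      by auto
  qed
  show ?thesis
    using step[of x y] step[of y x] assms dist_commute by (cases "D r y \<le> D r x") auto
qed

text \<open>
  Walk from \<open>w\<close> towards the root \<open>u\<close> by passing to the parent in each step.
\<close>
lemma geodesic_exists:
  assumes "u \<in> V" "w \<in> V"
  shows "\<exists>s. s 0 = u \<and> s (D u w) = w \<and> (\<forall>i\<le>D u w. s i \<in> V \<and> D u (s i) = i) \<and>
    (\<forall>i<D u w. D (s i) (s (Suc i)) = 1)"
  using assms(2)
proof (induction "D u w" arbitrary: w)
  case 0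
  then have "w = u" using assms(1) dist_eq_0 by auto
  with assms(1) show ?case by (intro exI[of _ "\<lambda>_. u"]) (auto simp: dist_self)
next
  case (Suc k)
  then have "w \<noteq> u" using assms(1) dist_self by force
  then obtain y where y: "y \<in> V" "D w y = 1" "Suc (D u y) = D u w"
    using parent_exists[OF assms(1) \<open>w \<in> V\<close>] by blast
  then have k: "D u y = k" using Suc by simp
  with Suc.hyps(1)[of y] y(1) obtain s where
    s: "s 0 = u" "s k = y" "\<forall>i\<le>k. s i \<in> V \<and> D u (s i) = i" "\<forall>i<k. D (s i) (s (Suc i)) = 1"
    by auto
  have "D y w = 1" using y Suc.prems dist_commute by simp
  with s y k Suc.prems Suc.hyps(2)[symmetric] show ?case
    by (intro exI[of _ "s(Suc k := w)"]) (auto simp: less_Suc_eq le_Suc_eq)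
qed

end

definition nat_dist :: "nat \<Rightarrow> nat \<Rightarrow> nat" where
  "nat_dist i j = (i - j) + (j - i)"

text \<open>
  The sum of the weighted distances from a pendent vertex attached at position \<open>j\<close> to the vertices
  of a path of length \<open>d\<close>.
\<close>

definition spread :: "(nat \<Rightarrow> real) \<Rightarrow> nat \<Rightarrow> nat \<Rightarrow> real" where
  "spread f d j = (\<Sum>i\<le>d. f (Suc (nat_dist i j)))"

text \<open>
  Consecutive vertices are adjacent and no vertex repeats; in a tree such a path is automatically
  geodesic (\<open>path_geodesic\<close>).
\<close>
locale tree_metric_path = tree_metric +
  fixes v :: "nat \<Rightarrow> 'a" and d :: nat
  assumes path_in_V: "i \<le> d \<Longrightarrow> v i \<in> V"
    and path_adjacent: "i < d \<Longrightarrow> D (v i) (v (Suc i)) = 1"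
    and path_inj: "inj_on v {..d}"
begin

definition off_path :: "'a set" where "off_path = V - v ` {..d}"

lemma off_pathD: "x \<in> off_path \<Longrightarrow> x \<in> V" "x \<in> off_path \<Longrightarrow> i \<le> d \<Longrightarrow> x \<noteq> v i"
  by (auto simp: off_path_def)

lemma finite_off_path: "finite off_path"
  using finite_V by (simp add: off_path_def)

lemma card_off_path: "card off_path = card V - Suc d"
proof -
  have "card (v ` {..d}) = Suc d" using path_inj by (simp add: card_image)
  then show ?thesis
    unfolding off_path_def using path_in_V by (subst card_Diff_subset) auto
qed

lemma path_step:
  assumes "x \<in> V" "i < d"
  shows "D x (v i) = Suc (D x (v (Suc i))) \<or> D x (v (Suc i)) = Suc (D x (v i))"
  using dist_adjacent_cases[OF assms(1) path_in_V path_in_V path_adjacent[OF assms(2)]] assms(2) by auto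

text \<open>
  The distance from \<open>x\<close> has no local maximum in the interior of the path: there both neighbours on
  the path would be parents of the same vertex with respect to the root \<open>x\<close>.
\<close>
lemma path_no_peak:
  assumes "x \<in> V" "Suc i < d" "D x (v i) < D x (v (Suc i))"
  shows "D x (v (Suc (Suc i))) = Suc (D x (v (Suc i)))"
proof (rule ccontr)
  assume "\<not> ?thesis"
  then have "D x (v (Suc (Suc i))) \<le> D x (v (Suc i))"
    using path_step[OF assms(1,2)] by auto
  moreover have "D (v (Suc i)) (v i) = 1" "D (v (Suc i)) (v (Suc (Suc i))) = 1"
    using path_adjacent[of i] path_adjacent[of "Suc i"] path_in_V dist_commute assms(2) by auto
  ultimately have "v i = v (Suc (Suc i))"
    using assms path_in_V by (intro parent_unique[of x "v (Suc i)"]) auto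
  then show False
    using path_inj assms(2) by (auto dest!: inj_onD)
qed

lemma dist_beyond_nearest:
  assumes "x \<in> V" and nearest: "\<And>i. i \<le> d \<Longrightarrow> D x (v j) \<le> D x (v i)"
  shows "j + k \<le> d \<Longrightarrow> D x (v (j + k)) = D x (v j) + k"
proof (induction k rule: less_induct)
  case (less k)
  show ?case
  proof (cases k)
    case 0
    then show ?thesis by simp
  next
    case (Suc l)
    then have l: "D x (v (j + l)) = D x (v j) + l" using less by simp
    show ?thesis
    proof (cases l)
      case 0
      then show ?thesis
        using path_step[OF assms(1), of j] nearest[of "Suc j"] less.prems Suc by auto
    next
      case (Suc i)
      then have "D x (v (j + i)) = D x (v j) + i" using less \<open>k = Suc l\<close> by simp
      then show ?thesis
        using path_no_peak[OF assms(1), of "j + i"] less.prems \<open>k = Suc l\<close> Suc l by simp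
    qed
  qed
qed

text \<open>
  By this symmetry it is enough to study one direction along the path, and to treat one of the two
  centres of a path of odd length.
\<close>
lemma reversed_path: "tree_metric_path V D (\<lambda>i. v (d - i)) d"
proof
  show "inj_on (\<lambda>i. v (d - i)) {..d}"
  proof (rule inj_onI)
    fix i k assume "i \<in> {..d}" "k \<in> {..d}" "v (d - i) = v (d - k)"
    then show "i = k" using inj_onD[OF path_inj, of "d - i" "d - k"] by simp
  qed
next
  fix i assume i: "i < d"
  then have "D (v (d - Suc i)) (v (Suc (d - Suc i))) = 1"
    by (intro path_adjacent) simp
  with i show "D (v (d - i)) (v (d - Suc i)) = 1"
    using path_in_V dist_commute by (simp add: Suc_diff_Suc)
qed (simp add: path_in_V)

text \<open>
  Consecutive distances differ by exactly one and there are no interior peaks, so the distance from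
  \<open>x\<close> is V-shaped along the path, with its minimum at the vertex where \<open>x\<close> branches off.
\<close>
lemma dist_to_path:
  assumes "x \<in> V"
  obtains j where "j \<le> d" "\<And>i. i \<le> d \<Longrightarrow> D x (v i) = D x (v j) + nat_dist i j"
proof -
  interpret rev: tree_metric_path V D "\<lambda>i. v (d - i)" d by (rule reversed_path)
  define j where "j = arg_min_on (\<lambda>i. D x (v i)) {..d}"
  have j: "j \<le> d" and nearest: "\<And>i. i \<le> d \<Longrightarrow> D x (v j) \<le> D x (v i)"
    unfolding j_def using arg_min_if_finite(1)[of "{..d}" "\<lambda>i. D x (v i)"]
      arg_min_least[of "{..d}" _ "\<lambda>i. D x (v i)"] by auto
  have "D x (v i) = D x (v j) + nat_dist i j" if "i \<le> d" for i
  proof (cases "j \<le> i")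
    case True
    then show ?thesis
      using dist_beyond_nearest[OF assms nearest, of "i - j"] that by (simp add: nat_dist_def)
  next
    case False
    then show ?thesis
      using rev.dist_beyond_nearest[OF assms, of "d - j" "j - i"] nearest j
      by (simp add: nat_dist_def)
  qed
  with j show thesis by (rule that)
qed

text \<open>
  Seen from a vertex of the path, the bottom of the V is that vertex, since there the distance is
  zero.
\<close>
lemma path_geodesic:
  assumes "i \<le> d" "k \<le> d"
  shows "D (v i) (v k) = nat_dist i k"
proof -
  obtain j where j: "j \<le> d" "\<And>l. l \<le> d \<Longrightarrow> D (v i) (v l) = D (v i) (v j) + nat_dist l j"
    using dist_to_path[OF path_in_V[OF assms(1)]] by blast
  have "D (v i) (v i) = 0" using path_in_V assms(1) by (simp add: dist_self)
  with j(2)[OF assms(1)] have "i = j" "D (v i) (v j) = 0"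
    by (auto simp: nat_dist_def)
  with j(2)[OF assms(2)] show ?thesis by (auto simp: nat_dist_def)
qed

lemma dist_off_path_pos: "x \<in> off_path \<Longrightarrow> i \<le> d \<Longrightarrow> D x (v i) > 0"
  using dist_eq_0[of x "v i"] off_pathD path_in_V by auto

lemma dist_attached:
  assumes "x \<in> off_path" "D x (v j) = 1" "j \<le> d" "i \<le> d"
  shows "D x (v i) = Suc (nat_dist i j)"
proof -
  obtain k where k: "k \<le> d" "\<And>l. l \<le> d \<Longrightarrow> D x (v l) = D x (v k) + nat_dist l k"
    using dist_to_path[OF off_pathD(1)[OF assms(1)]] by blast
  from k(2)[OF assms(3)] assms(2) dist_off_path_pos[OF assms(1) k(1)]
  have "k = j" by (auto simp: nat_dist_def)
  with k(2)[OF assms(4)] assms(2) show ?thesis by simp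
qed

text \<open>
  Two vertices attached at the same place are not adjacent: adjacent vertices have different
  distances to any third vertex.
\<close>
lemma dist_attached_same:
  assumes "x \<in> off_path" "y \<in> off_path" "x \<noteq> y" "D x (v j) = 1" "D y (v j) = 1" "j \<le> d"
  shows "D x y = 2"
  using dist_adjacent_cases[of x y "v j"] assms off_pathD path_in_V dist_eq_0[of x y] by auto

text \<open>
  Every edge between two vertices off the path joins one of them to its parent with respect to the
  root \<open>v 0\<close>.  In this way the pairs at distance one off the path are charged to single vertices.
\<close>
definition parent :: "'a \<Rightarrow> 'a" where
  "parent x = (SOME y. y \<in> V \<and> D x y = 1 \<and> Suc (D (v 0) y) = D (v 0) x)"

lemma parent_props:
  assumes "x \<in> off_path"
  shows "parent x \<in> V" "D x (parent x) = 1" "Suc (D (v 0) (parent x)) = D (v 0) x"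
proof -
  have "\<exists>y. y \<in> V \<and> D x y = 1 \<and> Suc (D (v 0) y) = D (v 0) x"
    using parent_exists[of "v 0" x] path_in_V[of 0] off_pathD[OF assms] by auto
  from someI_ex[OF this] show "parent x \<in> V" "D x (parent x) = 1" "Suc (D (v 0) (parent x)) = D (v 0) x"
    unfolding parent_def by blast+
qed

lemma lower_neighbour_is_parent:
  assumes "x \<in> off_path" "y \<in> V" "D x y = 1" "D (v 0) y \<le> D (v 0) x"
  shows "y = parent x"
  using parent_unique[of "v 0" x y "parent x"] parent_props[OF assms(1)] assms path_in_V[of 0]
    off_pathD(1) by auto

text \<open>
  A neighbour \<open>v i\<close> on the path is the parent of \<open>x\<close>; otherwise \<open>x\<close> would be the parent of
  \<open>v i\<close>, but for \<open>i > 0\<close> that is \<open>v (i - 1)\<close>, and \<open>v 0\<close> is the root.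
\<close>
lemma attached_imp_parent_on_path:
  assumes "x \<in> off_path" "i \<le> d" "D x (v i) = 1"
  shows "parent x = v i"
proof (cases "D (v 0) (v i) \<le> D (v 0) x")
  case True
  with lower_neighbour_is_parent assms path_in_V show ?thesis by metis
next
  case False
  then obtain k where k: "i = Suc k"
    using path_geodesic[of 0 i] assms(2) by (cases i) (auto simp: nat_dist_def)
  have "D (v i) (v k) = 1"
    using path_geodesic[of i k] k assms(2) by (simp add: nat_dist_def)
  moreover have "D (v i) x = 1"
    using assms path_in_V off_pathD dist_commute by metis
  moreover have "D (v 0) (v k) \<le> D (v 0) (v i)"
    using path_geodesic[of 0] k assms(2) by (simp add: nat_dist_def)
  ultimately have "x = v k"
    using False k assms path_in_V off_pathD(1) by (intro parent_unique[of "v 0" "v i"]) auto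
  then show ?thesis using off_pathD(2)[OF assms(1)] k assms(2) by auto
qed

lemma off_path_dist_2:
  assumes "x \<in> off_path" "parent x \<in> off_path" "i \<le> d"
  shows "D x (v i) \<ge> 2"
  using attached_imp_parent_on_path[OF assms(1,3)] dist_off_path_pos[OF assms(1,3)]
    off_pathD(2)[OF assms(2,3)] by linarith

end

section \<open>Increasing weights of distances\<close>

text \<open>
  Both parts of the result are about minimising the sum of an increasing function of the distances:
  \<open>k powr \<alpha>\<close> for positive \<open>\<alpha>\<close> and its negative for negative \<open>\<alpha>\<close>.  Monotonicity is
  required from \<open>1\<close> on only, because the value at \<open>0\<close> is fixed to \<open>0\<close>, which for negative
  \<open>\<alpha>\<close> lies above the other values.
\<close>
locale distance_weight =
  fixes f :: "nat \<Rightarrow> real"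
  assumes weight_0: "f 0 = 0"
    and weight_less_Suc: "1 \<le> k \<Longrightarrow> f k < f (Suc k)"
begin

lemma weight_less: "1 \<le> k \<Longrightarrow> k < l \<Longrightarrow> f k < f l"
proof (induction l)
  case (Suc l)
  then show ?case using weight_less_Suc[of k] weight_less_Suc[of l] by (cases "k = l") auto
qed simp

lemma weight_le: "1 \<le> k \<Longrightarrow> k \<le> l \<Longrightarrow> f k \<le> f l"
  using weight_less[of k l] by (cases "k = l") auto

text \<open>
  Moving the attachment point from \<open>j\<close> to \<open>j + 1\<close> brings one more vertex to its left and one fewer
  to its right: the multiset of distances loses \<open>d - j + 1\<close> and gains \<open>j + 2\<close>.  Left of the
  centre this lowers the sum, which is thus smallest exactly at the centres.
\<close>
lemma spread_Suc:
  assumes j: "j < d"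
  shows "spread f d j + f (j + 2) = spread f d (Suc j) + f (Suc (d - j))"
proof -
  have eq: "spread f d k = (\<Sum>i\<le>k. f (Suc i)) + (\<Sum>i\<in>{1..d - k}. f (Suc i))" if "k \<le> d" for k
  proof -
    have "{..d} = {..k} \<union> {Suc k..d}" using that by auto
    then have "spread f d k = (\<Sum>i\<le>k. f (Suc (nat_dist i k))) + (\<Sum>i\<in>{Suc k..d}. f (Suc (nat_dist i k)))"
      unfolding spread_def by (subst sum.union_disjoint[symmetric]) auto
    also have "(\<Sum>i\<le>k. f (Suc (nat_dist i k))) = (\<Sum>i\<le>k. f (Suc i))"
      by (rule sum.reindex_bij_witness[of _ "\<lambda>i. k - i" "\<lambda>i. k - i"]) (auto simp: nat_dist_def)
    also have "(\<Sum>i\<in>{Suc k..d}. f (Suc (nat_dist i k))) = (\<Sum>i\<in>{1..d - k}. f (Suc i))"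
      by (rule sum.reindex_bij_witness[of _ "\<lambda>i. i + k" "\<lambda>i. i - k"]) (auto simp: nat_dist_def)
    finally show ?thesis .
  qed
  have "d - j = Suc (d - Suc j)" using j by simp
  then have "(\<Sum>i\<in>{1..d - j}. f (Suc i)) = (\<Sum>i\<in>{1..d - Suc j}. f (Suc i)) + f (Suc (d - j))"
    by (simp add: sum.atLeast_Suc_atMost_Suc_shift)
  with eq[of j] eq[of "Suc j"] j show ?thesis by simp
qed

lemma spread_reverse: "j \<le> d \<Longrightarrow> spread f d (d - j) = spread f d j"
  unfolding spread_def
  by (rule sum.reindex_bij_witness[of _ "\<lambda>i. d - i" "\<lambda>i. d - i"]) 
    (auto simp: nat_dist_def intro!: arg_cong[of _ _ f])

lemma spread_centre_less_below:
  assumes "j < d div 2"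
  shows "spread f d (d div 2) < spread f d j"
proof -
  have step: "spread f d (Suc i) < spread f d i" if "i < d div 2" for i
    using spread_Suc[of i d] weight_less[of "i + 2" "Suc (d - i)"] that by linarith
  from assms show ?thesis
  proof (induction "d div 2 - j" arbitrary: j)
    case (Suc k)
    have less: "spread f d (Suc j) < spread f d j" using step Suc.prems .
    show ?case
    proof (cases "Suc j = d div 2")
      case True
      with less show ?thesis by simp
    next
      case False
      then have "spread f d (d div 2) < spread f d (Suc j)"
        using Suc.prems Suc.hyps(2) by (intro Suc.hyps(1)) auto
      with less show ?thesis by simp
    qed
  qed simp
qed

lemma spread_centre_less:
  assumes "j \<le> d" "j \<noteq> d div 2" "j \<noteq> d - d div 2"
  shows "spread f d (d div 2) < spread f d j"
proof (cases "j < d div 2")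
  case False
  with assms have "d - j < d div 2" by linarith
  from spread_centre_less_below[OF this] spread_reverse[OF assms(1)] show ?thesis by simp
qed (rule spread_centre_less_below)

lemma spread_centre_le: "j \<le> d \<Longrightarrow> spread f d (d div 2) \<le> spread f d j"
  using spread_centre_less[of j d] spread_reverse[of "d div 2" d] by fastforce

end

section \<open>The lower bound and its equality case\<close>

definition (in tree_metric) distance_sum :: "(nat \<Rightarrow> real) \<Rightarrow> real" where
  "distance_sum f = (\<Sum>x\<in>V. \<Sum>y\<in>V. f (D x y))"

text \<open>
  The sum over ordered pairs in a path of length \<open>d\<close> with \<open>m\<close> pendent vertices attached to a
  centre: pairs on the path, twice the mixed pairs, and pairs off the path, all at distance two.
\<close>
definition optimal_sum :: "(nat \<Rightarrow> real) \<Rightarrow> nat \<Rightarrow> nat \<Rightarrow> real" where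
  "optimal_sum f d m = (\<Sum>i\<le>d. \<Sum>k\<le>d. f (nat_dist i k)) + 2 * (real m * spread f d (d div 2))
     + real m * (real m - 1) * f 2"

locale weighted_tree_path = tree_metric_path + distance_weight
begin

lemma distance_sum_split:
  "distance_sum f = (\<Sum>i\<le>d. \<Sum>k\<le>d. f (nat_dist i k))
     + 2 * (\<Sum>x\<in>off_path. \<Sum>i\<le>d. f (D x (v i)))
     + (\<Sum>x\<in>off_path. \<Sum>y\<in>off_path. f (D x y))"
proof -
  let ?P = "v ` {..d}"
  have V: "V = ?P \<union> off_path" using path_in_V by (auto simp: off_path_def)
  have split: "sum g V = (\<Sum>i\<le>d. g (v i)) + sum g off_path" for g :: "'a \<Rightarrow> real"
  proof -
    have "sum g V = sum g ?P + sum g off_path"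
      by (subst V, rule sum.union_disjoint) (auto simp: finite_off_path off_path_def finite_V)
    then show ?thesis using path_inj by (simp add: sum.reindex)
  qed
  have "(\<Sum>i\<le>d. \<Sum>y\<in>off_path. f (D (v i) y)) = (\<Sum>i\<le>d. \<Sum>y\<in>off_path. f (D y (v i)))"
    by (intro sum.cong refl arg_cong[of _ _ f] dist_commute) (auto simp: path_in_V off_pathD)
  also have "\<dots> = (\<Sum>x\<in>off_path. \<Sum>i\<le>d. f (D x (v i)))"
    by (rule sum.swap)
  finally have swap: "(\<Sum>i\<le>d. \<Sum>y\<in>off_path. f (D (v i) y)) = (\<Sum>x\<in>off_path. \<Sum>i\<le>d. f (D x (v i)))" .
  have "(\<Sum>i\<le>d. \<Sum>k\<le>d. f (D (v i) (v k))) = (\<Sum>i\<le>d. \<Sum>k\<le>d. f (nat_dist i k))"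
    by (intro sum.cong refl) (simp add: path_geodesic)
  with swap show ?thesis
    unfolding distance_sum_def by (simp add: split sum.distrib)
qed

text \<open>
  A vertex whose parent is off the path pays for the edge to that parent: this pair is at distance
  one, whereas the bound counts every pair off the path with distance two.
\<close>
definition charge :: "'a \<Rightarrow> real" where
  "charge x = (if parent x \<in> off_path then f 2 - f 1 else 0)"

text \<open>
  Why a vertex can afford its charge: if the parent is off the path, all distances to the path are at
  least two.  At the branching vertex the weight then rises from \<open>f 1\<close> to at least \<open>f 2\<close>, which
  covers the charge, and the other distances only get larger than those of a pendent vertex.  As they
  become strictly larger, equality forces \<open>x\<close> to be attached to a centre.
\<close>
lemma off_path_sum:
  assumes "x \<in> off_path"
  shows "spread f d (d div 2) + charge x \<le> (\<Sum>i\<le>d. f (D x (v i)))"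
    and "(\<Sum>i\<le>d. f (D x (v i))) = spread f d (d div 2) + charge x \<Longrightarrow> 0 < d \<Longrightarrow>
      D x (v (d div 2)) = 1 \<or> D x (v (d - d div 2)) = 1"
proof -
  obtain j where j: "j \<le> d" "\<And>i. i \<le> d \<Longrightarrow> D x (v i) = D x (v j) + nat_dist i j"
    using dist_to_path[OF off_pathD(1)[OF assms]] by blast
  have pos: "D x (v j) \<ge> 1" using dist_off_path_pos[OF assms j(1)] by simp
  have le: "f (Suc (nat_dist i j)) \<le> f (D x (v i))" if "i \<le> d" for i
    using j(2)[OF that] pos by (intro weight_le) auto
  let ?near = "\<Sum>i\<in>{..d} - {j}. f (Suc (nat_dist i j))"
  let ?far = "\<Sum>i\<in>{..d} - {j}. f (D x (v i))"
  have near: "spread f d j = f 1 + ?near"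
    unfolding spread_def using j(1) by (subst sum.remove[of _ j]) (auto simp: nat_dist_def)
  have far: "(\<Sum>i\<le>d. f (D x (v i))) = f (D x (v j)) + ?far"
    using j(1) by (subst sum.remove[of _ j]) auto
  have near_far: "?near \<le> ?far"
    using le by (intro sum_mono) auto
  have charge: "charge x \<le> f (D x (v j)) - f 1"
    using off_path_dist_2[OF assms _ j(1)] weight_le[of 2 "D x (v j)"] weight_le[OF _ pos]
    by (auto simp: charge_def)
  show "spread f d (d div 2) + charge x \<le> (\<Sum>i\<le>d. f (D x (v i)))"
    using near far near_far charge spread_centre_le[OF j(1)] by linarith
  assume eq: "(\<Sum>i\<le>d. f (D x (v i))) = spread f d (d div 2) + charge x" and "0 < d"
  then have "spread f d j \<le> spread f d (d div 2)"
    using near far near_far charge by linarith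
  then have "j = d div 2 \<or> j = d - d div 2"
    using spread_centre_less[OF j(1)] by fastforce
  moreover have "D x (v j) = 1"
  proof (rule ccontr)
    assume "D x (v j) \<noteq> 1"
    with pos have "D x (v j) \<ge> 2" by simp
    then have "f (Suc (nat_dist i j)) < f (D x (v i))" if "i \<le> d" for i
      using j(2)[OF that] by (intro weight_less) auto
    moreover have "{..d} - {j} \<noteq> {}"
      using \<open>0 < d\<close> by (cases "j = 0") auto
    ultimately have "?near < ?far"
      by (intro sum_strict_mono) auto
    then show False
      using eq near far charge spread_centre_le[OF j(1)] by linarith
  qed
  ultimately show "D x (v (d div 2)) = 1 \<or> D x (v (d - d div 2)) = 1" by auto
qed

text \<open>
  The pair can be at distance one only if one vertex is the parent of the other; then the charge of
  the child makes up for it.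
\<close>
lemma off_path_pair:
  assumes "x \<in> off_path" "y \<in> off_path" "x \<noteq> y"
  shows "f 2 \<le> f (D x y) + (if y = parent x then f 2 - f 1 else 0) + (if x = parent y then f 2 - f 1 else 0)"
proof (cases "D x y = 1")
  case True
  moreover have "D y x = 1" using True assms off_pathD(1) dist_commute by metis
  ultimately have "y = parent x \<or> x = parent y"
    using lower_neighbour_is_parent[of x y] lower_neighbour_is_parent[of y x] assms off_pathD(1)
      linear by blast
  with True show ?thesis using weight_le[of 1 2] by auto
next
  case False
  moreover have "D x y \<noteq> 0" using assms off_pathD(1) dist_eq_0 by auto
  ultimately have "f 2 \<le> f (D x y)" by (intro weight_le) auto
  then show ?thesis using weight_le[of 1 2] by auto
qed

text \<open>
  The mixed pairs count twice, so each charge is subtracted twice there; it is added back in the pairs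
  off the path, once for each order of the vertex and its parent.  With the charges distributed like
  this, every single summand is nonnegative.
\<close>
lemma distance_sum_excess:
  defines "c \<equiv> d div 2"
  defines "pc \<equiv> \<lambda>x y. if y = parent x then f 2 - f 1 else 0"
  shows "distance_sum f - optimal_sum f d (card off_path) =
     2 * (\<Sum>x\<in>off_path. (\<Sum>i\<le>d. f (D x (v i))) - (spread f d c + charge x))
     + (\<Sum>x\<in>off_path. \<Sum>y\<in>off_path. if x = y then 0 else f (D x y) + pc x y + pc y x - f 2)"
proof -
  have noself: "parent x \<noteq> x" if "x \<in> off_path" for x
    using parent_props(3)[OF that] by auto
  have pc: "(\<Sum>y\<in>off_path. pc x y) = charge x" for x
    by (simp add: pc_def charge_def sum.delta finite_off_path)
  have pc': "(\<Sum>x\<in>off_path. \<Sum>y\<in>off_path. pc y x) = sum charge off_path"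
    by (subst sum.swap) (simp add: pc)
  have diag: "(\<Sum>x\<in>off_path. \<Sum>y\<in>off_path. if x = y then f 2 else 0) = real (card off_path) * f 2"
    by (simp add: sum.delta finite_off_path)
  have "(\<Sum>x\<in>off_path. \<Sum>y\<in>off_path. if x = y then 0 else f (D x y) + pc x y + pc y x - f 2)
     = (\<Sum>x\<in>off_path. \<Sum>y\<in>off_path. f (D x y) + pc x y + pc y x - f 2 + (if x = y then f 2 else 0))"
    using noself[symmetric] by (intro sum.cong refl) (auto simp: pc_def dist_self off_pathD weight_0)
  also have "\<dots> = (\<Sum>x\<in>off_path. \<Sum>y\<in>off_path. f (D x y)) + 2 * sum charge off_path
      - real (card off_path) * (real (card off_path) - 1) * f 2"
    using pc' diag by (simp add: sum.distrib sum_subtractf pc algebra_simps)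
  finally show ?thesis
    unfolding distance_sum_split optimal_sum_def
    by (simp add: sum.distrib sum_subtractf c_def algebra_simps)
qed

lemma excess_pair_nonneg:
  assumes "x \<in> off_path" "y \<in> off_path"
  shows "0 \<le> (if x = y then 0 else f (D x y) + (if y = parent x then f 2 - f 1 else 0)
    + (if x = parent y then f 2 - f 1 else 0) - f 2)"
  using off_path_pair[OF assms] by simp

lemma optimal_sum_le: "optimal_sum f d (card off_path) \<le> distance_sum f"
proof -
  have "0 \<le> distance_sum f - optimal_sum f d (card off_path)"
    unfolding distance_sum_excess using off_path_sum(1) excess_pair_nonneg
    by (intro add_nonneg_nonneg mult_nonneg_nonneg sum_nonneg) auto
  then show ?thesis by simp
qed

text \<open>
  If the excess vanishes then so does every summand.  The mixed summands attach each vertex off the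
  path to a centre, and the others put these vertices at mutual distance two.  Two different centres
  cannot both occur, since vertices attached to them would be at distance three.
\<close>
lemma attached_of_distance_sum_eq:
  assumes "distance_sum f = optimal_sum f d (card off_path)" "0 < d"
  shows "(\<forall>x\<in>off_path. D x (v (d div 2)) = 1) \<or> (\<forall>x\<in>off_path. D x (v (d - d div 2)) = 1)"
proof -
  let ?A = "\<lambda>x. (\<Sum>i\<le>d. f (D x (v i))) - (spread f d (d div 2) + charge x)"
  let ?B = "\<lambda>x y. if x = y then 0 else f (D x y) + (if y = parent x then f 2 - f 1 else 0)
    + (if x = parent y then f 2 - f 1 else 0) - f 2"
  have A: "0 \<le> ?A x" if "x \<in> off_path" for x
    using off_path_sum(1)[OF that] by simp
  have B: "0 \<le> (\<Sum>y\<in>off_path. ?B x y)" if "x \<in> off_path" for x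
    using excess_pair_nonneg[OF that] by (rule sum_nonneg)
  have "2 * sum ?A off_path + (\<Sum>x\<in>off_path. \<Sum>y\<in>off_path. ?B x y) = 0"
    using distance_sum_excess assms(1) by simp
  moreover have "0 \<le> sum ?A off_path" using A by (rule sum_nonneg)
  moreover have "0 \<le> (\<Sum>x\<in>off_path. \<Sum>y\<in>off_path. ?B x y)" using B by (rule sum_nonneg)
  ultimately have "sum ?A off_path = 0" and sumB: "(\<Sum>x\<in>off_path. \<Sum>y\<in>off_path. ?B x y) = 0"
    by linarith+
  then have "?A x = 0" if "x \<in> off_path" for x
    using that A finite_off_path by (subst (asm) sum_nonneg_eq_0_iff) auto
  then have centre: "D x (v (d div 2)) = 1 \<or> D x (v (d - d div 2)) = 1" if "x \<in> off_path" for x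
    using off_path_sum(2)[OF that _ assms(2)] that by (simp add: algebra_simps)
  have parent: "parent x \<notin> off_path" if "x \<in> off_path" for x
    using off_path_dist_2[OF that, of "d div 2"] off_path_dist_2[OF that, of "d - d div 2"]
      centre[OF that] by auto
  have dist2: "D x y = 2" if xy: "x \<in> off_path" "y \<in> off_path" "x \<noteq> y" for x y
  proof -
    have "(\<Sum>y\<in>off_path. ?B x y) = 0"
      using sumB B finite_off_path xy(1) by (subst (asm) sum_nonneg_eq_0_iff) auto
    then have "?B x y = 0"
      using excess_pair_nonneg[OF xy(1)] finite_off_path xy(2)
      by (subst (asm) sum_nonneg_eq_0_iff) auto
    moreover have "y \<noteq> parent x" "x \<noteq> parent y" using xy parent by auto
    ultimately have "f (D x y) = f 2" using xy(3) by simp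
    moreover have "D x y \<ge> 1"
      using xy off_pathD(1) dist_eq_0[of x y] by (metis less_one not_le)
    ultimately show ?thesis
      using weight_less[of "D x y" 2] weight_less[of 2 "D x y"] by (cases "D x y" "2::nat" rule: linorder_cases) auto
  qed
  show ?thesis
  proof (rule ccontr)
    assume "\<not> ?thesis"
    then obtain x y where xy: "x \<in> off_path" "y \<in> off_path"
      and x: "D x (v (d div 2)) \<noteq> 1" and y: "D y (v (d - d div 2)) \<noteq> 1" by auto
    define k where "k = d div 2"
    define k' where "k' = d - d div 2"
    have k: "k \<le> d" "k' \<le> d" "k' \<le> Suc k" "k \<le> k'" by (auto simp: k_def k'_def)
    have x': "D x (v k') = 1" and y': "D y (v k) = 1"
      using x y xy centre unfolding k_def k'_def by blast+
    have "k \<noteq> k'" using x x' k_def by auto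
    \<comment> \<open>Now \<open>x\<close> is at distance two both from \<open>y\<close> and from the neighbour \<open>v k\<close> of \<open>y\<close>.\<close>
    then have "D x (v k) = 2"
      using dist_attached[OF xy(1) x' k(2) k(1)] k by (simp add: nat_dist_def)
    moreover have "x \<noteq> y" using x y' k_def by auto
    ultimately show False
      using dist_adjacent_cases[of x y "v k"] dist2[OF xy] y' xy off_pathD(1) path_in_V[OF k(1)] by auto
  qed
qed

lemma distance_sum_attached:
  assumes "\<And>x. x \<in> off_path \<Longrightarrow> D x (v (d div 2)) = 1"
  shows "distance_sum f = optimal_sum f d (card off_path)"
proof -
  have "(\<Sum>i\<le>d. f (D x (v i))) = spread f d (d div 2)" if "x \<in> off_path" for x
    unfolding spread_def using dist_attached[OF that assms[OF that]] by (intro sum.cong) auto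
  then have "(\<Sum>x\<in>off_path. \<Sum>i\<le>d. f (D x (v i))) = real (card off_path) * spread f d (d div 2)"
    by simp
  moreover have "f (D x y) = (if x = y then 0 else f 2)" if "x \<in> off_path" "y \<in> off_path" for x y
    using dist_attached_same[OF that _ assms[OF that(1)] assms[OF that(2)]] that
    by (auto simp: dist_self off_pathD weight_0)
  then have "(\<Sum>x\<in>off_path. \<Sum>y\<in>off_path. f (D x y))
      = (\<Sum>x\<in>off_path. \<Sum>y\<in>off_path. if x = y then 0 else f 2)"
    by (intro sum.cong refl)
  ultimately have "distance_sum f = (\<Sum>i\<le>d. \<Sum>k\<le>d. f (nat_dist i k))
     + 2 * (real (card off_path) * spread f d (d div 2))
     + (\<Sum>x\<in>off_path. \<Sum>y\<in>off_path. if x = y then 0 else f 2)"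
    unfolding distance_sum_split by simp
  also have "(\<Sum>x\<in>off_path. \<Sum>y\<in>off_path. if x = y then 0 else f 2)
      = (\<Sum>x\<in>off_path. \<Sum>y\<in>off_path. f 2 - (if x = y then f 2 else 0))"
    by (intro sum.cong) auto
  also have "\<dots> = real (card off_path) * (real (card off_path) - 1) * f 2"
    by (simp add: sum_subtractf sum.delta finite_off_path algebra_simps)
  finally show ?thesis by (simp add: optimal_sum_def)
qed

end

text \<open>
  When all vertices off the path hang on one vertex of it, the distances are determined, so any
  bijection that matches the paths position by position preserves them.
\<close>
lemma attached_isometry:
  assumes "tree_metric_path V D v d" "tree_metric_path V' D' v' d" "card V = card V'" "j \<le> d"
    and att: "\<And>x. x \<in> tree_metric_path.off_path V v d \<Longrightarrow> D x (v j) = 1"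
    and att': "\<And>x. x \<in> tree_metric_path.off_path V' v' d \<Longrightarrow> D' x (v' j) = 1"
  shows "\<exists>\<phi>. bij_betw \<phi> V V' \<and> (\<forall>x\<in>V. \<forall>y\<in>V. D' (\<phi> x) (\<phi> y) = D x y)"
proof -
  interpret T: tree_metric_path V D v d by fact
  interpret T': tree_metric_path V' D' v' d by fact
  have "card T.off_path = card T'.off_path"
    using assms(3) T.card_off_path T'.card_off_path by simp
  then obtain h where h: "bij_betw h T.off_path T'.off_path"
    using finite_same_card_bij[OF T.finite_off_path T'.finite_off_path] by blast
  define \<phi> where "\<phi> x = (if x \<in> T.off_path then h x else v' (the_inv_into {..d} v x))" for x
  have \<phi>v: "\<phi> (v i) = v' i" if "i \<le> d" for i
    using that T.off_pathD(2) the_inv_into_f_f[OF T.path_inj] by (auto simp: \<phi>_def)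
  have \<phi>h: "\<phi> x = h x" if "x \<in> T.off_path" for x using that by (simp add: \<phi>_def)
  have hO: "h x \<in> T'.off_path" if "x \<in> T.off_path" for x
    using h that by (auto simp: bij_betw_def)
  have V: "V = v ` {..d} \<union> T.off_path" using T.path_in_V by (auto simp: T.off_path_def)
  have V': "V' = v' ` {..d} \<union> T'.off_path" using T'.path_in_V by (auto simp: T'.off_path_def)
  have iso: "D' (\<phi> x) (\<phi> y) = D x y" if xy: "x \<in> V" "y \<in> V" for x y
  proof -
    have on: "x \<in> T.off_path \<or> (\<exists>i\<le>d. x = v i)" "y \<in> T.off_path \<or> (\<exists>i\<le>d. y = v i)"
      using xy V by auto
    have mixed: "D' (\<phi> a) (\<phi> (v i)) = D a (v i)" if "a \<in> T.off_path" "i \<le> d" for a i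
      using that \<phi>v \<phi>h hO T.dist_attached[OF that(1) att assms(4) that(2)]
        T'.dist_attached[OF hO att' assms(4) that(2)] by simp
    have mixed': "D' (\<phi> (v i)) (\<phi> a) = D (v i) a" if "a \<in> T.off_path" "i \<le> d" for a i
      using mixed[OF that] that \<phi>v \<phi>h hO T.dist_commute T'.dist_commute T.off_pathD(1) T'.off_pathD(1)
        T.path_in_V T'.path_in_V by metis
    have path: "D' (\<phi> (v i)) (\<phi> (v k)) = D (v i) (v k)" if "i \<le> d" "k \<le> d" for i k
      using that \<phi>v T.path_geodesic T'.path_geodesic by simp
    have off: "D' (\<phi> a) (\<phi> b) = D a b" if "a \<in> T.off_path" "b \<in> T.off_path" for a b
    proof (cases "a = b")
      case True
      then show ?thesis using that \<phi>h hO T.off_pathD(1) T'.off_pathD(1) T.dist_self T'.dist_self by simp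
    next
      case False
      then have "h a \<noteq> h b" using h that by (auto simp: bij_betw_def dest: inj_onD)
      then show ?thesis
        using T.dist_attached_same[OF that False att att assms(4)] that \<phi>h
          T'.dist_attached_same[OF hO hO _ att' att' assms(4)] hO by simp
    qed
    show ?thesis using on mixed mixed' path off by blast
  qed
  have "inj_on \<phi> V"
  proof (rule inj_onI)
    fix x y assume xy: "x \<in> V" "y \<in> V" and "\<phi> x = \<phi> y"
    have "x \<in> v ` {..d} \<or> x \<in> T.off_path" using xy(1) V by blast
    then have "\<phi> x \<in> V'"
      using T'.off_pathD(1)[OF hO] T'.path_in_V by (auto simp: \<phi>v \<phi>h)
    then have "D' (\<phi> x) (\<phi> y) = 0" using \<open>\<phi> x = \<phi> y\<close> T'.dist_self by simp
    then show "x = y" using iso[OF xy] T.dist_eq_0[OF xy] by simp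
  qed
  moreover have "\<phi> ` V = V'"
  proof -
    have "\<phi> ` V = (\<phi> \<circ> v) ` {..d} \<union> \<phi> ` T.off_path" by (subst V) (simp add: image_Un image_comp)
    also have "(\<phi> \<circ> v) ` {..d} = v' ` {..d}" using \<phi>v by (intro image_cong) auto
    also have "\<phi> ` T.off_path = T'.off_path" using h \<phi>h by (simp add: bij_betw_def)
    finally show ?thesis using V' by simp
  qed
  ultimately show ?thesis using iso unfolding bij_betw_def by blast
qed

section \<open>The tree with all pendent edges at a centre\<close>

lemma centre_tree_simps:
  "pverts (centre_tree d n) = {..<n}"
  "(x, y) \<in> parcs (centre_tree d n) \<longleftrightarrow>
     (x < d \<and> y = Suc x) \<or> (y < d \<and> x = Suc y) \<or>
     (x = d div 2 \<and> d < y \<and> y < n) \<or> (y = d div 2 \<and> d < x \<and> x < n)"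
  by (auto simp: centre_tree_def Let_def)

lemma pair_graph_centre_tree:
  assumes "d < n"
  shows "pair_graph (centre_tree d n)"
proof
  have sub: "parcs (centre_tree d n) \<subseteq> {..<n} \<times> {..<n}"
    using assms by (auto simp: centre_tree_simps)
  then show "finite (parcs (centre_tree d n))"
    by (rule finite_subset) simp
  show "symmetric (with_proj (centre_tree d n))"
    by (auto simp: symmetric_def sym_def centre_tree_simps)
  fix e assume e: "e \<in> parcs (centre_tree d n)"
  with sub show "fst e \<in> pverts (centre_tree d n)" "snd e \<in> pverts (centre_tree d n)"
    by (auto simp: centre_tree_simps(1))
  obtain x y where xy: "e = (x, y)" by (cases e)
  have "x \<noteq> y"
  proof
    assume "x = y"
    with e xy show False by (simp add: centre_tree_simps(2)) linarith
  qed
  with xy show "fst e \<noteq> snd e" by simp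
qed (simp add: centre_tree_simps)

text \<open>
  Every vertex other than \<open>0\<close> has exactly one neighbour with a smaller label.  Uniqueness excludes
  cycles, with the label as rank, and existence leads from every vertex down to \<open>0\<close>.
\<close>
lemma undirected_tree_centre_tree:
  assumes "d < n"
  shows "undirected_tree (centre_tree d n)"
proof -
  let ?C = "centre_tree d n"
  interpret pair_graph ?C using assms by (rule pair_graph_centre_tree)
  have acyc: "\<not> (\<exists>p. cycle p \<and> length p \<ge> 3)"
  proof -
    have "length p < 3" if "cycle p" for p
      using that by (rule no_cycle_if_ranked[of "\<lambda>x. x", rotated]) (auto simp: centre_tree_simps)
    then show ?thesis by (meson not_less)
  qed
  have root: "x \<rightarrow>\<^sup>*\<^bsub>with_proj ?C\<^esub> 0" if "x < n" for x
    using that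
  proof (induction x rule: less_induct)
    case (less x)
    show ?case
    proof (cases "x = 0")
      case True
      then show ?thesis using less.prems by (auto simp: centre_tree_simps)
    next
      case False
      define y where "y = (if x \<le> d then x - 1 else d div 2)"
      have "y < x" "(x, y) \<in> parcs ?C"
        using False less.prems assms by (auto simp: y_def centre_tree_simps)
      with less show ?thesis
        by (auto intro: adj_reachable_trans)
    qed
  qed
  have "strongly_connected (with_proj ?C)"
  proof
    show "verts (with_proj ?C) \<noteq> {}" using assms by (auto simp: centre_tree_simps)
  next
    fix u w assume "u \<in> verts (with_proj ?C)" "w \<in> verts (with_proj ?C)"
    then have "u \<rightarrow>\<^sup>*\<^bsub>with_proj ?C\<^esub> 0" "w \<rightarrow>\<^sup>*\<^bsub>with_proj ?C\<^esub> 0"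
      using root by (auto simp: centre_tree_simps)
    then show "u \<rightarrow>\<^sup>*\<^bsub>with_proj ?C\<^esub> w"
      using symmetric_reachable[OF pair_sym_arcs] reachable_trans by blast
  qed
  moreover have "pverts (mk_symmetric (with_proj ?C)) = pverts ?C"
    by (simp add: mk_symmetric_def)
  ultimately have "Digraph_Component.connected (with_proj ?C)"
    by (simp add: connected_def strongly_connected_def reachable_mk_symmetric_eq[OF pair_sym_arcs])
  with acyc pair_graph show ?thesis
    unfolding undirected_tree_def by (intro conjI)
qed

lemma centre_tree_path:
  assumes "d < n"
  shows "tree_metric_path (pverts (centre_tree d n)) (hop_dist (centre_tree d n)) (\<lambda>i. i) d"
proof -
  have "tree_metric (pverts (centre_tree d n)) (hop_dist (centre_tree d n))"
    by (rule undirected_tree_imp_tree_metric[OF undirected_tree_centre_tree[OF assms]])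
  then interpret tree_metric "pverts (centre_tree d n)" "hop_dist (centre_tree d n)" .
  show ?thesis
  proof
    fix i assume "i < d"
    with assms have "i \<in> pverts (centre_tree d n)" "Suc i \<in> pverts (centre_tree d n)"
      "(i, Suc i) \<in> parcs (centre_tree d n)"
      by (simp_all add: centre_tree_simps)
    then show "hop_dist (centre_tree d n) i (Suc i) = 1"
      using hop_dist_arc_iff[OF undirected_tree_centre_tree[OF assms]] by blast
  qed (use assms in \<open>auto simp: centre_tree_simps\<close>)
qed

lemma centre_tree_attached:
  assumes "d < n" "x \<in> tree_metric_path.off_path (pverts (centre_tree d n)) (\<lambda>i. i) d"
  shows "hop_dist (centre_tree d n) x (d div 2) = 1"
proof -
  interpret tree_metric_path "pverts (centre_tree d n)" "hop_dist (centre_tree d n)" "\<lambda>i. i" d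
    using assms(1) by (rule centre_tree_path)
  from assms(2) have x: "d < x" "x < n" unfolding off_path_def by (auto simp: centre_tree_simps)
  with assms(1) have "x \<in> pverts (centre_tree d n)" "d div 2 \<in> pverts (centre_tree d n)"
    "(x, d div 2) \<in> parcs (centre_tree d n)"
    by (simp_all add: centre_tree_simps)
  then show ?thesis
    using hop_dist_arc_iff[OF undirected_tree_centre_tree[OF assms(1)]] by blast
qed

text \<open>
  Two pendent vertices attached to the centre are at distance two, which is where \<open>2 \<le> d\<close> matters.
\<close>
lemma gdiameter_centre_tree:
  assumes "2 \<le> d" "d < n"
  shows "gdiameter (centre_tree d n) = real d"
proof -
  let ?C = "centre_tree d n"
  interpret tree_metric_path "pverts ?C" "hop_dist ?C" "\<lambda>i. i" d
    using assms(2) by (rule centre_tree_path)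
  note att = centre_tree_attached[OF assms(2)]
  have V: "x \<le> d \<or> x \<in> off_path" if "x \<in> pverts ?C" for x
    using that by (auto simp: off_path_def)
  have le: "hop_dist ?C x y \<le> d" if xy: "x \<in> pverts ?C" "y \<in> pverts ?C" for x y
  proof -
    have mixed: "hop_dist ?C a i \<le> d" if "a \<in> off_path" "i \<le> d" for a i
      using dist_attached[OF that(1) att[OF that(1)] _ that(2)] that(2) assms(1)
      by (simp add: nat_dist_def)
    have "hop_dist ?C a b \<le> d" if "a \<in> off_path" "b \<in> off_path" for a b
      using dist_attached_same[OF that _ att[OF that(1)] att[OF that(2)]] dist_self off_pathD(1)[OF that(1)] assms(1)
      by (cases "a = b") auto
    moreover have "hop_dist ?C i k \<le> d" if "i \<le> d" "k \<le> d" for i k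
      using path_geodesic[OF that] that by (simp add: nat_dist_def)
    ultimately show ?thesis
      using V[OF xy(1)] V[OF xy(2)] mixed dist_commute[OF xy] by metis
  qed
  have eq: "{gdist ?C u v |u v. u \<in> pverts ?C \<and> v \<in> pverts ?C}
      = (\<lambda>(u, v). real (hop_dist ?C u v)) ` (pverts ?C \<times> pverts ?C)" (is "?L = ?R")
    using gdist_eq_hop_dist[OF undirected_tree_centre_tree[OF assms(2)]] by force
  show ?thesis
    unfolding gdiameter_def eq
  proof (rule Max_eqI)
    have "hop_dist ?C 0 d = d" using path_geodesic[of 0 d] by (simp add: nat_dist_def)
    then show "real d \<in> ?R"
      using path_in_V[of 0] path_in_V[of d] by (intro image_eqI[of _ _ "(0, d)"]) auto
  qed (use le finite_V in auto)
qed

lemma centre_tree_in_trees_order_diameter: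
  assumes "2 \<le> d" "d < n"
  shows "centre_tree d n \<in> trees_order_diameter n d"
  using gdiameter_centre_tree[OF assms] undirected_tree_centre_tree[OF assms(2)]
  by (simp add: trees_order_diameter_def centre_tree_simps)

section \<open>Extremality and uniqueness\<close>

lemma diametral_path_exists:
  assumes "T \<in> trees_order_diameter n d" "1 \<le> n"
  obtains v where "tree_metric_path (pverts T) (hop_dist T) v d"
proof -
  have T: "undirected_tree T" and card: "card (pverts T) = n" and diam: "gdiameter T = real d"
    using assms(1) by (auto simp: trees_order_diameter_def)
  interpret tree_metric "pverts T" "hop_dist T" using T by (rule undirected_tree_imp_tree_metric)
  have eq: "{gdist T u v |u v. u \<in> pverts T \<and> v \<in> pverts T}
      = (\<lambda>(u, v). real (hop_dist T u v)) ` (pverts T \<times> pverts T)"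
    using gdist_eq_hop_dist[OF T] by force
  have "real d \<in> (\<lambda>(u, v). real (hop_dist T u v)) ` (pverts T \<times> pverts T)"
    unfolding diam[symmetric] gdiameter_def eq
    using finite_V card assms(2) by (intro Max_in) auto
  then obtain u w where u: "u \<in> pverts T" "w \<in> pverts T" "hop_dist T u w = d" by auto
  from geodesic_exists[OF u(1,2)] u(3) obtain s where
    s: "\<forall>i\<le>d. s i \<in> pverts T \<and> hop_dist T u (s i) = i" "\<forall>i<d. hop_dist T (s i) (s (Suc i)) = 1"
    by auto
  then have "inj_on s {..d}" by (metis atMost_iff inj_onI)
  with s have "tree_metric_path (pverts T) (hop_dist T) s d" by unfold_locales auto
  then show thesis by (rule that)
qed

lemma digraph_iso_if_isometry:
  assumes "undirected_tree G" "undirected_tree H" "bij_betw \<phi> (pverts G) (pverts H)"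
    and iso: "\<forall>x\<in>pverts G. \<forall>y\<in>pverts G. hop_dist H (\<phi> x) (\<phi> y) = hop_dist G x y"
  shows "digraph_iso (with_proj G) (with_proj H)"
proof (rule digraph_isoI_arcs[OF _ assms(3)])
  show "pair_wf_digraph G" "pair_wf_digraph H"
    using assms(1,2) by (auto simp: undirected_tree_def pair_graph_def pair_digraph_def pair_fin_digraph_def)
next
  fix x y assume "x \<in> pverts G" "y \<in> pverts G"
  moreover have "\<phi> x \<in> pverts H" "\<phi> y \<in> pverts H"
    using calculation assms(3) by (auto simp: bij_betw_def)
  ultimately show "(x, y) \<in> parcs G \<longleftrightarrow> (\<phi> x, \<phi> y) \<in> parcs H"
    using hop_dist_arc_iff[OF assms(1)] hop_dist_arc_iff[OF assms(2)] iso by metis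
qed

text \<open>
  Both trees are compared with the common value of \<open>optimal_sum\<close>: the tree \<open>T\<close> lies above it by
  the lower bound applied to a diametral path, and the centre tree attains it.
\<close>
lemma centre_tree_unique_minimiser:
  assumes "distance_weight f" "2 \<le> d" "d < n" "T \<in> trees_order_diameter n d"
  shows "tree_metric.distance_sum (pverts (centre_tree d n)) (hop_dist (centre_tree d n)) f
      \<le> tree_metric.distance_sum (pverts T) (hop_dist T) f"
    and "tree_metric.distance_sum (pverts T) (hop_dist T) f
        = tree_metric.distance_sum (pverts (centre_tree d n)) (hop_dist (centre_tree d n)) f \<Longrightarrow>
      digraph_iso (with_proj T) (with_proj (centre_tree d n))"
proof -
  let ?C = "centre_tree d n"
  have T: "undirected_tree T" and card: "card (pverts T) = n"
    using assms(4) by (auto simp: trees_order_diameter_def)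
  note C = undirected_tree_centre_tree[OF assms(3)]
  obtain v where v: "tree_metric_path (pverts T) (hop_dist T) v d"
    using diametral_path_exists[OF assms(4)] assms(3) by auto
  interpret T: weighted_tree_path "pverts T" "hop_dist T" v d f
    using v assms(1) by (rule weighted_tree_path.intro)
  interpret C: weighted_tree_path "pverts ?C" "hop_dist ?C" "\<lambda>i. i" d f
    using centre_tree_path[OF assms(3)] assms(1) by (rule weighted_tree_path.intro)
  note att = centre_tree_attached[OF assms(3)]
  have cards: "card (pverts T) = card (pverts ?C)" by (simp add: card centre_tree_simps)
  then have m: "card T.off_path = card C.off_path"
    by (simp add: T.card_off_path C.card_off_path)
  have opt: "C.distance_sum f = optimal_sum f d (card T.off_path)"
    unfolding m using att by (rule C.distance_sum_attached)
  then show "C.distance_sum f \<le> T.distance_sum f"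
    using T.optimal_sum_le by simp
  assume "T.distance_sum f = C.distance_sum f"
  with opt T.attached_of_distance_sum_eq assms(2)
  consider "\<forall>x\<in>T.off_path. hop_dist T x (v (d div 2)) = 1"
    | "\<forall>x\<in>T.off_path. hop_dist T x (v (d - d div 2)) = 1" by auto
  \<comment> \<open>If the pendent vertices hang on the second centre, reversing the path makes it the first.\<close>
  then obtain w where w: "tree_metric_path (pverts T) (hop_dist T) w d"
    and watt: "\<And>x. x \<in> tree_metric_path.off_path (pverts T) w d \<Longrightarrow> hop_dist T x (w (d div 2)) = 1"
  proof cases
    case 1
    with v show thesis by (intro that) auto
  next
    case 2
    interpret rev: tree_metric_path "pverts T" "hop_dist T" "\<lambda>i. v (d - i)" d
      by (rule T.reversed_path)
    have "v i \<in> (\<lambda>i. v (d - i)) ` {..d}" if "i \<le> d" for i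
      using that by (intro image_eqI[of _ _ "d - i"]) auto
    then have "(\<lambda>i. v (d - i)) ` {..d} = v ` {..d}" by auto
    then have "rev.off_path = T.off_path" by (simp add: rev.off_path_def T.off_path_def)
    with 2 T.reversed_path show thesis by (intro that) auto
  qed
  obtain \<phi> where "bij_betw \<phi> (pverts T) (pverts ?C)"
    "\<forall>x\<in>pverts T. \<forall>y\<in>pverts T. hop_dist ?C (\<phi> x) (\<phi> y) = hop_dist T x y"
    using attached_isometry[OF w centre_tree_path[OF assms(3)] cards _ watt att] by auto
  with T C show "digraph_iso (with_proj T) (with_proj ?C)" by (rule digraph_iso_if_isometry)
qed

lemma distance_weight_powr: "0 < \<alpha> \<Longrightarrow> distance_weight (\<lambda>k. real k powr \<alpha>)"
  by unfold_locales (auto intro: powr_less_mono2)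

lemma distance_weight_neg_powr: "\<alpha> < 0 \<Longrightarrow> distance_weight (\<lambda>k. - (real k powr \<alpha>))"
  by unfold_locales (auto intro: powr_less_mono2_neg)

lemma distance_sum_powr:
  assumes "undirected_tree G"
  shows "tree_metric.distance_sum (pverts G) (hop_dist G) (\<lambda>k. real k powr \<alpha>) = 2 * wiener \<alpha> G"
    and "tree_metric.distance_sum (pverts G) (hop_dist G) (\<lambda>k. - (real k powr \<alpha>)) = - 2 * wiener \<alpha> G"
proof -
  interpret tree_metric "pverts G" "hop_dist G" using assms by (rule undirected_tree_imp_tree_metric)
  show "distance_sum (\<lambda>k. real k powr \<alpha>) = 2 * wiener \<alpha> G"
    "distance_sum (\<lambda>k. - (real k powr \<alpha>)) = - 2 * wiener \<alpha> G"
    unfolding distance_sum_def using twice_wiener_eq[OF assms, of \<alpha>] by (simp_all add: sum_negf)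
qed

theorem corollary4:
  fixes d n :: nat
  assumes "1 < d" and "d \<le> n - 1"
  shows "centre_tree d n \<in> trees_order_diameter n d \<and>
    (\<forall>\<alpha>::real. \<alpha> > 0 \<longrightarrow>
      (\<forall>T :: 'a pair_pre_digraph. T \<in> trees_order_diameter n d \<longrightarrow>
        wiener \<alpha> (centre_tree d n) \<le> wiener \<alpha> T \<and>
        (wiener \<alpha> T = wiener \<alpha> (centre_tree d n) \<longrightarrow>
          digraph_iso (with_proj T) (with_proj (centre_tree d n))))) \<and>
    (\<forall>\<alpha>::real. \<alpha> < 0 \<longrightarrow>
      (\<forall>T :: 'a pair_pre_digraph. T \<in> trees_order_diameter n d \<longrightarrow>
        wiener \<alpha> T \<le> wiener \<alpha> (centre_tree d n) \<and>
        (wiener \<alpha> T = wiener \<alpha> (centre_tree d n) \<longrightarrow>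
          digraph_iso (with_proj T) (with_proj (centre_tree d n)))))"
proof (intro conjI allI impI)
  have d: "2 \<le> d" "d < n" using assms by auto
  show "centre_tree d n \<in> trees_order_diameter n d"
    using d by (rule centre_tree_in_trees_order_diameter)
  note C = distance_sum_powr[OF undirected_tree_centre_tree[OF d(2)]]
  fix \<alpha> :: real and T :: "'a pair_pre_digraph"
  assume T: "T \<in> trees_order_diameter n d"
  then have "undirected_tree T" by (simp add: trees_order_diameter_def)
  note W = distance_sum_powr[OF this]
  {
    assume "\<alpha> > 0"
    note opt = centre_tree_unique_minimiser[OF distance_weight_powr[OF this] d T, unfolded C W]
    show "wiener \<alpha> (centre_tree d n) \<le> wiener \<alpha> T" using opt(1) by simp
    assume "wiener \<alpha> T = wiener \<alpha> (centre_tree d n)"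
    then show "digraph_iso (with_proj T) (with_proj (centre_tree d n))" using opt(2) by simp
  next
    assume "\<alpha> < 0"
    note opt = centre_tree_unique_minimiser[OF distance_weight_neg_powr[OF this] d T, unfolded C W]
    show "wiener \<alpha> T \<le> wiener \<alpha> (centre_tree d n)" using opt(1) by simp
    assume "wiener \<alpha> T = wiener \<alpha> (centre_tree d n)"
    then show "digraph_iso (with_proj T) (with_proj (centre_tree d n))" using opt(2) by simp
  }
qed

end
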